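(* Let $\mathbb K$ be a field and let $V$ be a $6$-dimensional vector space over $\mathbb K$. Line-spreads of $\mathrm{PG}(V)$ induced by hyperplanes of $\mathcal G_3(V)$ exist (i.e. there exists a hyperplane $H$ of $\mathcal G_3(V)$ such that $R^{\uparrow}(H)$ is a line-spread of $\mathrm{PG}(V)$) if and only if $\mathbb K$ is not quadratically closed.
   Context: $\mathcal G_3(V)$ is the Grassmannian whose points are the 3-dimensional subspaces of $V$. Its hyperplanes are exactly the sets $H=\{\langle x,y,z\rangle : \dim=3,\ h(x\wedge y\wedge z)=0\}$ for $h$ a non-zero linear functional on $\bigwedge^3V$ (equivalently, a non-zero alternating trilinear form on $V$). The upper radical $R^{\uparrow}(H)$ is the set of lines of $\mathrm{PG}(V)$, i.e. 2-dimensional subspaces $Y$ of $V$, such that every 3-dimensional subspace containing $Y$ belongs to $H$; equivalently $Y=\langle x,y\rangle$ with $h(x\wedge y\wedge z)=0$ for all $z\in V$. A line-spread of $\mathrm{PG}(V)$ is a set of lines partitioning the points of $\mathrm{PG}(V)$. A field $\mathbb K$ is quadratically closed if it has no field extension of degree $2$ (equivalently no irreducible polynomial of degree 2 in $\mathbb K[t]$), in any characteristic. *)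

theory Defs
  imports Complex_Main "HOL-Computational_Algebra.Polynomial"
begin

definition quadratically_closed :: "'k::field itself \<Rightarrow> bool" where
  "quadratically_closed _ \<longleftrightarrow> \<not> (\<exists>p :: 'k poly. degree p = 2 \<and> irreducible p)"

text \<open>The index \<open>k\<close> is the vector dimension: the points, lines and planes of \<open>PG(V)\<close>
  are \<open>grassmannian scale 1\<close>, \<open>grassmannian scale 2\<close> and \<open>grassmannian scale 3\<close>.\<close>

definition grassmannian ::
    "('k::field \<Rightarrow> 'v::ab_group_add \<Rightarrow> 'v) \<Rightarrow> nat \<Rightarrow> 'v set set" where
  "grassmannian scale k = {W. module.subspace scale W \<and> vector_space.dim scale W = k}"

text \<open>Linear functionals on the third exterior power of \<open>V\<close> are represented by the
  alternating trilinear forms \<open>h x y z\<close> on \<open>V\<close> that they induce. ``Alternating'' means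
  vanishing on repeated arguments, not merely skew-symmetric, so that characteristic 2 is
  covered.\<close>

definition alternating_trilinear_form ::
    "('k::field \<Rightarrow> 'v::ab_group_add \<Rightarrow> 'v) \<Rightarrow> ('v \<Rightarrow> 'v \<Rightarrow> 'v \<Rightarrow> 'k) \<Rightarrow> bool" where
  "alternating_trilinear_form scale h \<longleftrightarrow>
     (\<forall>y z. Vector_Spaces.linear scale (*) (\<lambda>x. h x y z)) \<and>
     (\<forall>x z. Vector_Spaces.linear scale (*) (\<lambda>y. h x y z)) \<and>
     (\<forall>x y. Vector_Spaces.linear scale (*) (\<lambda>z. h x y z)) \<and>
     (\<forall>x y z. x = y \<or> x = z \<or> y = z \<longrightarrow> h x y z = 0)"

definition hyperplane_of_form ::
    "('k::field \<Rightarrow> 'v::ab_group_add \<Rightarrow> 'v) \<Rightarrow> ('v \<Rightarrow> 'v \<Rightarrow> 'v \<Rightarrow> 'k) \<Rightarrow> 'v set set" where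
  "hyperplane_of_form scale h =
     {module.span scale {x, y, z} | x y z.
        vector_space.dim scale (module.span scale {x, y, z}) = 3 \<and> h x y z = 0}"

definition is_hyperplane ::
    "('k::field \<Rightarrow> 'v::ab_group_add \<Rightarrow> 'v) \<Rightarrow> 'v set set \<Rightarrow> bool" where
  "is_hyperplane scale H \<longleftrightarrow>
     (\<exists>h. alternating_trilinear_form scale h \<and> (\<exists>x y z. h x y z \<noteq> 0) \<and>
          H = hyperplane_of_form scale h)"

definition upper_radical ::
    "('k::field \<Rightarrow> 'v::ab_group_add \<Rightarrow> 'v) \<Rightarrow> 'v set set \<Rightarrow> 'v set set" where
  "upper_radical scale H =
     {Y \<in> grassmannian scale 2. \<forall>W \<in> grassmannian scale 3. Y \<subseteq> W \<longrightarrow> W \<in> H}"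

definition line_spread ::
    "('k::field \<Rightarrow> 'v::ab_group_add \<Rightarrow> 'v) \<Rightarrow> 'v set set \<Rightarrow> bool" where
  "line_spread scale S \<longleftrightarrow>
     S \<subseteq> grassmannian scale 2 \<and> (\<forall>P \<in> grassmannian scale 1. \<exists>!Y. Y \<in> S \<and> P \<subseteq> Y)"

end

theory Submission
  imports Defs
begin

text \<open>
Let \<open>h\<close> be a non-zero alternating trilinear form. A line \<open>\<langle>x, y\<rangle>\<close> lies in the upper radical of the
hyperplane of \<open>h\<close> exactly when \<open>h x y z = 0\<close> for all \<open>z\<close> (\<open>upper_radical_iff\<close>): whether \<open>h\<close>
vanishes on a basis of a plane does not depend on the basis. So the upper radical is a line-spread
if and only if for every \<open>x \<noteq> 0\<close> the alternating bilinear form \<open>h x\<close> has a radical of dimension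
exactly 2.

Suppose that this holds over a quadratically closed field. Choose a line \<open>\<langle>x, x'\<rangle>\<close> of the spread
and a complement \<open>C\<close> of it, of dimension 4. On \<open>C\<close> the Pfaffian of the alternating bilinear form
\<open>h (s x + t x')\<close> is a binary quadratic form in \<open>s, t\<close>, and over a quadratically closed field such a
form has a zero \<open>(s, t) \<noteq> (0, 0)\<close> (\<open>quadratically_closed_isotropic\<close>). For \<open>u = s x + t x'\<close> there is
then a non-zero \<open>w\<close> in \<open>C\<close> in the radical of \<open>h u\<close> restricted to \<open>C\<close>
(\<open>alternating_4x4_kernel\<close>), hence in the radical of \<open>h u\<close>. So \<open>\<langle>x, x'\<rangle>\<close> and \<open>\<langle>u, w\<rangle>\<close> are two lines of
the spread through the point \<open>\<langle>u\<rangle>\<close>, a contradiction.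

Conversely, let \<open>t^2 - \<alpha> t - \<beta>\<close> be irreducible over \<open>K\<close>, put \<open>L = K[t] / (t^2 - \<alpha> t - \<beta>)\<close>, and
identify \<open>V\<close> with \<open>L^3\<close>. Compose the determinant of \<open>L^3\<close> with a non-zero \<open>K\<close>-linear functional
\<open>L \<rightarrow> K\<close>; this is an alternating trilinear form \<open>h\<close> over \<open>K\<close>. The upper radical consists of the
\<open>L\<close>-lines \<open>L x\<close>, and these partition the non-zero vectors. The only properties of \<open>h\<close> used for this
are that it is non-zero and that multiplication by \<open>t\<close>, a linear map \<open>J\<close> on \<open>V\<close>, can be moved
between its three arguments (\<open>radical_in_J_line\<close>). If \<open>\<langle>x, y\<rangle>\<close> is in the upper radical and \<open>y\<close> is not in
\<open>L x\<close>, then a third vector \<open>z\<close> gives \<open>V = (L x + L y) + L z\<close>, and \<open>h\<close> vanishes as soon as two of its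
arguments are in the same one of these two summands. Of three arguments two always are, so \<open>h = 0\<close>.
\<close>

section \<open>Quadratic polynomials and binary quadratic forms\<close>

lemma irreducible_quadratic_iff_no_root:
  fixes p :: "'k::field poly"
  assumes "degree p = 2"
  shows "irreducible p \<longleftrightarrow> (\<forall>r. poly p r \<noteq> 0)"
proof
  assume irr: "irreducible p"
  show "\<forall>r. poly p r \<noteq> 0"
  proof (intro allI notI)
    fix r assume "poly p r = 0"
    then obtain q where q: "p = [:-r, 1:] * q"
      by (auto simp: poly_eq_0_iff_dvd elim: dvdE)
    with assms have "q \<noteq> 0" by auto
    with q assms have "degree q = 1"
      by (simp add: degree_mult_eq del: mult_pCons_left)
    moreover have "[:-r, 1:] dvd 1 \<or> q dvd 1"
      using irreducibleD[OF irr q] .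
    ultimately show False
      using \<open>q \<noteq> 0\<close> by (simp add: is_unit_iff_degree)
  qed
next
  assume no_root: "\<forall>r. poly p r \<noteq> 0"
  have "p \<noteq> 0" using assms by auto
  show "irreducible p"
  proof (rule irreducibleI)
    show "p \<noteq> 0" by fact
    show "\<not> p dvd 1" using assms \<open>p \<noteq> 0\<close> by (simp add: is_unit_iff_degree)
    fix a b assume ab: "p = a * b"
    with \<open>p \<noteq> 0\<close> have nz: "a \<noteq> 0" "b \<noteq> 0" by auto
    have no_linear: "degree c \<noteq> 1" if "c dvd p" for c
    proof
      assume "degree c = 1"
      then obtain u v where "c = [:u, v:]" "v \<noteq> 0"
        by (metis degree1_coeffs)
      then have "poly c (- u / v) = 0" by simp
      with \<open>c dvd p\<close> no_root show False by (metis dvd_trans poly_eq_0_iff_dvd)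
    qed
    have "degree a \<noteq> 1" "degree b \<noteq> 1"
      by (rule no_linear, simp add: ab)+
    moreover have "degree a + degree b = 2"
      using assms ab nz by (simp add: degree_mult_eq)
    ultimately have "degree a = 0 \<or> degree b = 0" by arith
    with nz show "a dvd 1 \<or> b dvd 1" by (auto simp: is_unit_iff_degree)
  qed
qed

lemma quadratically_closed_isotropic:
  fixes A B C :: "'k::field"
  assumes "quadratically_closed TYPE('k)"
  obtains s t where "s \<noteq> 0 \<or> t \<noteq> 0" "A * s^2 + B * s * t + C * t^2 = 0"
proof (cases "A = 0")
  case True
  then show ?thesis using that[of 1 0] by simp
next
  case False
  then have "degree [:C, B, A:] = 2" by simp
  with assms obtain r where "poly [:C, B, A:] r = 0"
    unfolding quadratically_closed_def using irreducible_quadratic_iff_no_root by blast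
  then show ?thesis using that[of r 1] by (simp add: algebra_simps power2_eq_square)
qed

lemma not_quadratically_closed_monic:
  assumes "\<not> quadratically_closed TYPE('k::field)"
  obtains \<alpha> \<beta> :: "'k::field" where "\<And>r. r^2 \<noteq> \<alpha> * r + \<beta>"
proof -
  obtain p :: "'k poly" where p: "degree p = 2" "irreducible p"
    using assms unfolding quadratically_closed_def by blast
  then obtain c b a where abc: "p = [:c, b, a:]" "a \<noteq> 0"
    by (metis degree2_coeffs)
  have "r^2 \<noteq> (- b / a) * r + (- c / a)" for r
  proof
    assume "r^2 = (- b / a) * r + (- c / a)"
    then have "poly p r = 0"
      using abc by (simp add: field_simps power2_eq_square)
    with p irreducible_quadratic_iff_no_root show False by blast
  qed
  then show ?thesis using that by blast
qed

section \<open>Degenerate alternating matrices of size four\<close>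

text \<open>
The four rows of the Pfaffian adjugate multiply the matrix to its Pfaffian times the identity. So
when the Pfaffian vanishes each of these rows is in the kernel, and they are all zero only if the
whole matrix is zero and every vector is in its kernel.
\<close>

lemma alternating_4x4_kernel:
  fixes a :: "nat \<Rightarrow> nat \<Rightarrow> 'k::field"
  assumes diag: "\<And>i. a i i = 0" and skew: "\<And>i j. a j i = - a i j"
    and pfaffian: "a 0 1 * a 2 3 - a 0 2 * a 1 3 + a 0 3 * a 1 2 = 0"
  obtains c where "\<exists>i<4. c i \<noteq> 0" "\<And>j. j < 4 \<Longrightarrow> (\<Sum>i<4. c i * a i j) = 0"
proof -
  have below4: "(\<forall>i<4. P i) \<longleftrightarrow> P 0 \<and> P 1 \<and> P 2 \<and> P 3" for P :: "nat \<Rightarrow> bool"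
    by (auto simp: less_Suc_eq numeral_eq_Suc)
  define K where "K c \<longleftrightarrow> (\<forall>j<4. (\<Sum>i<4. c i * a i j) = 0)" for c
  have sum4: "(\<Sum>i<4. f i) = f 0 + f 1 + f 2 + f 3" for f :: "nat \<Rightarrow> 'k"
    by (simp add: eval_nat_numeral)
  note sk = skew[of 1 0] skew[of 2 0] skew[of 3 0] skew[of 2 1] skew[of 3 1] skew[of 3 2]
  define row where "row p q r s = (\<lambda>i. [p, q, r, s] ! i)" for p q r s :: 'k
  have row: "row p q r s 0 = p" "row p q r s 1 = q" "row p q r s 2 = r" "row p q r s 3 = s" for p q r s
    by (simp_all add: row_def)
  have rows: "K (row 0 (a 2 3) (- a 1 3) (a 1 2))" "K (row (- a 2 3) 0 (a 0 3) (- a 0 2))"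
    "K (row (a 1 3) (- a 0 3) 0 (a 0 1))" "K (row (- a 1 2) (a 0 2) (- a 0 1) 0)"
    using pfaffian unfolding K_def below4 sum4 row diag sk
    by (auto simp: algebra_simps)
  have ones: "K (\<lambda>_. 1)" if "\<forall>i<4. \<forall>j<4. a i j = 0"
    using that unfolding K_def by (auto intro!: sum.neutral)
  have nonzero: "\<exists>i<4. row p q r s i \<noteq> 0" if "p \<noteq> 0 \<or> q \<noteq> 0 \<or> r \<noteq> 0 \<or> s \<noteq> 0" for p q r s
    using that below4[of "\<lambda>i. row p q r s i = 0"] unfolding row by blast
  have "\<exists>c. (\<exists>i<4. c i \<noteq> 0) \<and> K c"
  proof (cases "\<forall>i<4. \<forall>j<4. a i j = 0")
    case True
    with ones have "K (\<lambda>_. 1)" by blast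
    moreover have "\<exists>i<4. (\<lambda>_ :: nat. 1 :: 'k) i \<noteq> 0" by (intro exI[of _ 0]) simp
    ultimately show ?thesis by (intro exI[of _ "\<lambda>_. 1"] conjI)
  next
    case False
    then have "a 0 1 \<noteq> 0 \<or> a 0 2 \<noteq> 0 \<or> a 0 3 \<noteq> 0 \<or> a 1 2 \<noteq> 0 \<or> a 1 3 \<noteq> 0 \<or> a 2 3 \<noteq> 0"
      unfolding below4 diag sk by auto
    then show ?thesis
      using rows nonzero by (metis neg_equal_0_iff_equal)
  qed
  then show ?thesis using that unfolding K_def by blast
qed


section \<open>Points and lines of the projective space\<close>

context finite_dimensional_vector_space
begin

lemma subspace_basis_extend:
  assumes "independent S" "S \<subseteq> W" "subspace W"
  obtains B where "S \<subseteq> B" "independent B" "span B = W" "card B = dim W" "finite B"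
proof -
  obtain B where B: "S \<subseteq> B" "B \<subseteq> W" "independent B" "W \<subseteq> span B"
    using maximal_independent_subset_extend[OF assms(2,1)] by blast
  moreover have "span B = W"
    using B assms(3) by (simp add: span_minimal subset_antisym)
  ultimately show ?thesis
    using that basis_card_eq_dim finiteI_independent by metis
qed

lemma grassmannian_1_obtain:
  assumes "P \<in> grassmannian scale 1"
  obtains x where "x \<noteq> 0" "P = span {x}"
proof -
  have P: "subspace P" "dim P = 1"
    using assms by (auto simp: grassmannian_def)
  obtain B where B: "independent B" "span B = P" "card B = 1"
    using subspace_basis_extend[OF independent_empty _ P(1)] P(2) by force
  then obtain x where "B = {x}" by (auto simp: card_1_singleton_iff)
  with B that show ?thesis by auto
qed

lemma span_singleton_in_grassmannian:
  "x \<noteq> 0 \<Longrightarrow> span {x} \<in> grassmannian scale 1"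
  by (simp add: grassmannian_def dim_eq_card_independent)

lemma grassmannian_2_obtain:
  assumes "Y \<in> grassmannian scale 2" "x \<in> Y" "x \<noteq> 0"
  obtains y where "x \<noteq> y" "independent {x, y}" "Y = span {x, y}"
proof -
  have Y: "subspace Y" "dim Y = 2"
    using assms by (auto simp: grassmannian_def)
  obtain B where B: "{x} \<subseteq> B" "independent B" "span B = Y" "card B = 2"
    using subspace_basis_extend[of "{x}" Y] Y assms by auto
  then obtain y where "B = {x, y}" "x \<noteq> y" by (auto simp: card_2_iff)
  with B that show ?thesis by auto
qed

lemma span_pair_in_grassmannian:
  "x \<noteq> y \<Longrightarrow> independent {x, y} \<Longrightarrow> span {x, y} \<in> grassmannian scale 2"
  by (simp add: grassmannian_def dim_eq_card_independent)

lemma complement_combination_not_in_span: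
  fixes n :: nat
  assumes "independent (S \<union> e ` {..<n})" "inj_on e {..<n}" "S \<inter> e ` {..<n} = {}"
    and "k < n" "c k \<noteq> 0"
  shows "(\<Sum>i<n. c i *s e i) \<notin> span S"
proof
  let ?R = "S \<union> e ` ({..<n} - {k})"
  assume "(\<Sum>i<n. c i *s e i) \<in> span S"
  then have "(\<Sum>i<n. c i *s e i) \<in> span ?R"
    by (meson Un_upper1 span_mono subsetD)
  moreover have "(\<Sum>i\<in>{..<n} - {k}. c i *s e i) \<in> span ?R"
    by (intro span_sum span_scale span_base) auto
  ultimately have "(\<Sum>i<n. c i *s e i) - (\<Sum>i\<in>{..<n} - {k}. c i *s e i) \<in> span ?R"
    by (rule span_diff)
  moreover have "(\<Sum>i<n. c i *s e i) = c k *s e k + (\<Sum>i\<in>{..<n} - {k}. c i *s e i)"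
    using \<open>k < n\<close> by (intro sum.remove) auto
  ultimately have "c k *s e k \<in> span ?R" by simp
  then have "inverse (c k) *s (c k *s e k) \<in> span ?R" by (rule span_scale)
  then have "e k \<in> span ?R" using \<open>c k \<noteq> 0\<close> by simp
  moreover have "?R = (S \<union> e ` {..<n}) - {e k}"
    using assms(2-4) by (auto dest: inj_onD)
  moreover have "e k \<in> S \<union> e ` {..<n}" using \<open>k < n\<close> by auto
  ultimately show False using assms(1) by (auto simp: dependent_def)
qed

end

section \<open>The upper radical of an alternating trilinear form\<close>

locale alternating_trilinear = finite_dimensional_vector_space scale Basis
  for scale :: "'k::field \<Rightarrow> 'v::ab_group_add \<Rightarrow> 'v" (infixr \<open>*s\<close> 75) and Basis +
  fixes h :: "'v \<Rightarrow> 'v \<Rightarrow> 'v \<Rightarrow> 'k"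
  assumes alternating_trilinear: "alternating_trilinear_form scale h"
begin

lemma add:
  "h (x + x') y z = h x y z + h x' y z"
  "h x (y + y') z = h x y z + h x y' z"
  "h x y (z + z') = h x y z + h x y z'"
  and scale:
  "h (c *s x) y z = c * h x y z"
  "h x (c *s y) z = c * h x y z"
  "h x y (c *s z) = c * h x y z"
  and repeated: "h x x z = 0" "h x y x = 0" "h x y y = 0"
  using alternating_trilinear unfolding alternating_trilinear_form_def Vector_Spaces.linear_iff by simp_all

lemma zero: "h 0 y z = 0" "h x 0 z = 0" "h x y 0 = 0"
  using scale(1)[of 0 0 y z] scale(2)[of x 0 0 z] scale(3)[of x y 0 0] by simp_all

lemma swap: "h y x z = - h x y z" "h x z y = - h x y z"
proof -
  have "h (x + y) (x + y) z = 0" "h x (y + z) (y + z) = 0" by (rule repeated)+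
  note this[unfolded add, unfolded repeated]
  then show "h y x z = - h x y z" "h x z y = - h x y z"
    by (simp_all add: eq_neg_iff_add_eq_0 add.commute)
qed

lemma sum_middle: "h x (\<Sum>i\<in>I. f i) z = (\<Sum>i\<in>I. h x (f i) z)"
  by (induction I rule: infinite_finite_induct) (simp_all add: add zero)

lemma vanishes_on_spans:
  assumes "\<And>a b c. a \<in> A \<Longrightarrow> b \<in> B \<Longrightarrow> c \<in> C \<Longrightarrow> h a b c = 0"
    and "x \<in> span A" "y \<in> span B" "z \<in> span C"
  shows "h x y z = 0"
proof -
  have 1: "h x b c = 0" if "b \<in> B" "c \<in> C" for b c
    using assms(2) by (induction rule: span_induct_alt) (simp_all add: that assms(1) zero add scale)
  have 2: "h x y c = 0" if "c \<in> C" for c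
    using assms(3) by (induction rule: span_induct_alt) (simp_all add: that 1 zero add scale)
  show ?thesis
    using assms(4) by (induction rule: span_induct_alt) (simp_all add: 2 zero add scale)
qed

text \<open>
Membership in a hyperplane is defined by the existence of a spanning triple on which the form
vanishes; by this lemma the form then vanishes on every triple in that plane.
\<close>

lemma vanishes_on_plane:
  assumes "h a b c = 0" "x \<in> span {a, b, c}" "y \<in> span {a, b, c}" "z \<in> span {a, b, c}"
  shows "h x y z = 0"
proof (rule vanishes_on_spans[OF _ assms(2-4)])
  have "h a c b = 0" "h b a c = 0" "h b c a = 0" "h c a b = 0" "h c b a = 0"
    using assms(1) swap(2)[of a c b] swap(1)[of b a c] swap(2)[of b c a] swap(1)[of c a b] swap(1)[of c b a]
    by simp_all
  with assms(1) show "h p q r = 0" if "p \<in> {a, b, c}" "q \<in> {a, b, c}" "r \<in> {a, b, c}" for p q r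
    using that by (auto simp: repeated)
qed

lemma upper_radical_iff:
  assumes "x \<noteq> y" "independent {x, y}"
  shows "span {x, y} \<in> upper_radical scale (hyperplane_of_form scale h) \<longleftrightarrow> (\<forall>z. h x y z = 0)"
proof
  assume rad: "span {x, y} \<in> upper_radical scale (hyperplane_of_form scale h)"
  have in_span: "x \<in> span S" if "x \<in> S" for x S by (simp add: span_base that)
  show "\<forall>z. h x y z = 0"
  proof
    fix z
    show "h x y z = 0"
    proof (cases "z \<in> span {x, y}")
      case True
      show ?thesis
        by (rule vanishes_on_plane[of x y x]) (use True in \<open>auto simp: repeated in_span insert_commute\<close>)
    next
      case False
      then have ind: "independent {x, y, z}" and "z \<notin> {x, y}"
        using assms independent_insertI[of z "{x, y}"] in_span by (auto simp: insert_commute)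
      then have "card {x, y, z} = 3" using assms(1) by auto
      then have "span {x, y, z} \<in> grassmannian scale 3"
        using ind by (simp add: grassmannian_def dim_eq_card_independent)
      moreover have "span {x, y} \<subseteq> span {x, y, z}" by (rule span_mono) auto
      ultimately have "span {x, y, z} \<in> hyperplane_of_form scale h"
        using rad by (auto simp: upper_radical_def)
      then obtain a b c where "span {x, y, z} = span {a, b, c}" "h a b c = 0"
        by (auto simp: hyperplane_of_form_def)
      then show ?thesis
        using vanishes_on_plane[of a b c x y z] in_span[of _ "{x, y, z}"] by auto
    qed
  qed
next
  assume rad: "\<forall>z. h x y z = 0"
  have "W \<in> hyperplane_of_form scale h"
    if W: "W \<in> grassmannian scale 3" "span {x, y} \<subseteq> W" for W
  proof -
    have "subspace W" "dim W = 3" using W by (auto simp: grassmannian_def)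
    moreover have "{x, y} \<subseteq> W" using W(2) span_superset by blast
    ultimately obtain B where B: "{x, y} \<subseteq> B" "span B = W" "card B = 3" "finite B"
      using subspace_basis_extend[OF assms(2)] by metis
    have "card (B - {x, y}) = 1"
      using B assms(1) by (simp add: card_Diff_subset)
    then obtain z where "B - {x, y} = {z}" by (auto simp: card_1_singleton_iff)
    with B have "B = {x, y, z}" by auto
    with B rad \<open>dim W = 3\<close> show ?thesis
      unfolding hyperplane_of_form_def by blast
  qed
  then show "span {x, y} \<in> upper_radical scale (hyperplane_of_form scale h)"
    using span_pair_in_grassmannian[OF assms] by (simp add: upper_radical_def)
qed

section \<open>Line-spreads over quadratically closed fields\<close>

text \<open>
The spread line \<open>\<langle>x, x'\<rangle>\<close> carries a pencil of alternating bilinear forms on a complement of dimension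
4. A member of the pencil with zero Pfaffian yields a second spread line through one of its points.
\<close>

lemma line_spread_imp_not_quadratically_closed:
  assumes dim6: "card Basis = 6"
    and spread: "line_spread scale (upper_radical scale (hyperplane_of_form scale h))"
  shows "\<not> quadratically_closed TYPE('k)"
proof
  assume qc: "quadratically_closed TYPE('k)"
  let ?S = "upper_radical scale (hyperplane_of_form scale h)"
  obtain x where "x \<in> Basis" using dim6 by fastforce
  then have "x \<noteq> 0" using independent_Basis dependent_zero by blast
  then obtain Y where Y: "Y \<in> ?S" "span {x} \<subseteq> Y"
    using spread span_singleton_in_grassmannian unfolding line_spread_def by blast
  have "Y \<in> grassmannian scale 2" using Y by (simp add: upper_radical_def)
  moreover have "x \<in> Y" using Y(2) span_superset by blast
  ultimately obtain x' where x': "x \<noteq> x'" "independent {x, x'}" "Y = span {x, x'}"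
    using grassmannian_2_obtain \<open>x \<noteq> 0\<close> by metis
  then have rad: "h x x' z = 0" for z using Y(1) upper_radical_iff by blast
  obtain B where B: "{x, x'} \<subseteq> B" "independent B" "span B = UNIV" "card B = 6" "finite B"
    using subspace_basis_extend[OF x'(2) subset_UNIV subspace_UNIV] dim6 by auto
  have "card (B - {x, x'}) = 4"
    using B x'(1) by (simp add: card_Diff_subset)
  then obtain e :: "nat \<Rightarrow> 'v" where e: "bij_betw e {..<4} (B - {x, x'})"
    using ex_bij_betw_nat_finite[of "B - {x, x'}"] B(5) by (auto simp: atLeast0LessThan)
  have eB: "e ` {..<4} = B - {x, x'}" "inj_on e {..<4}"
    using e by (auto simp: bij_betw_def)
  \<comment> \<open>Below, the coefficients of \<open>s^2\<close> and \<open>t^2\<close> are the Pfaffians of \<open>a\<close> and \<open>a'\<close>, and the coefficient of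
    \<open>s * t\<close> is their polarization, so that the form is the Pfaffian of \<open>s a + t a'\<close>.\<close>
  define a a' where "a i j = h x (e i) (e j)" and "a' i j = h x' (e i) (e j)" for i j
  obtain s t where st: "s \<noteq> 0 \<or> t \<noteq> 0"
    "(a 0 1 * a 2 3 - a 0 2 * a 1 3 + a 0 3 * a 1 2) * s^2
     + (a 0 1 * a' 2 3 + a' 0 1 * a 2 3 - a 0 2 * a' 1 3 - a' 0 2 * a 1 3
        + a 0 3 * a' 1 2 + a' 0 3 * a 1 2) * s * t
     + (a' 0 1 * a' 2 3 - a' 0 2 * a' 1 3 + a' 0 3 * a' 1 2) * t^2 = 0"
    using quadratically_closed_isotropic[OF qc] by blast
  define u where "u = s *s x + t *s x'"
  define m where "m i j = h u (e i) (e j)" for i j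
  have m: "m i j = s * a i j + t * a' i j" for i j
    by (simp add: m_def a_def a'_def u_def add scale)
  have "m 0 1 * m 2 3 - m 0 2 * m 1 3 + m 0 3 * m 1 2 = 0"
    using st(2) unfolding m by (simp add: algebra_simps power2_eq_square)
  moreover have "m i i = 0" "m j i = - m i j" for i j
    by (simp_all add: m_def repeated swap(2)[of u "e j" "e i"])
  ultimately obtain c where c: "\<exists>i<4. c i \<noteq> 0" "\<And>j. j < 4 \<Longrightarrow> (\<Sum>i<4. c i * m i j) = 0"
    using alternating_4x4_kernel[of m] by blast
  define w where "w = (\<Sum>i<4. c i *s e i)"
  obtain k where k: "k < 4" "c k \<noteq> 0" using c(1) by blast
  have "{x, x'} \<union> e ` {..<4} = B" using B(1) eB(1) by auto
  then have w: "w \<notin> Y"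
    unfolding w_def x'(3)
    using complement_combination_not_in_span[of "{x, x'}" e 4 k c] B(2) eB k by auto
  have u: "u \<in> Y" unfolding u_def x'(3) by (intro span_add span_scale span_base) auto
  \<comment> \<open>On the complement this is the choice of \<open>w\<close>; on the spread line it holds because both \<open>u\<close> and \<open>b\<close>
    lie in that line.\<close>
  have "h u w b = 0" if "b \<in> B" for b
  proof (cases "b \<in> {x, x'}")
    case True
    have "h u b w = 0"
      using True rad swap(1)[of x x'] unfolding u_def by (auto simp: add scale repeated)
    then show ?thesis using swap(2)[of u w b] by simp
  next
    case False
    then have "b \<in> e ` {..<4}" using that eB(1) by simp
    then obtain j where "j < 4" "b = e j" by auto
    then show ?thesis
      using c(2) by (simp add: w_def sum_middle scale m_def)
  qed
  note basis_vanish = this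
  have "h u w z = 0" for z
    by (rule vanishes_on_spans[of "{u}" "{w}" B]) (auto simp: B(3) span_base basis_vanish)
  moreover have "u \<noteq> 0"
  proof
    assume "u = 0"
    then have "(\<Sum>v\<in>{x, x'}. (if v = x then s else t) *s v) = 0"
      using x'(1) by (simp add: u_def)
    then have "(if v = x then s else t) = 0" if "v \<in> {x, x'}" for v
      using independentD[OF x'(2), of "{x, x'}" "\<lambda>v. if v = x then s else t" v] that by simp
    from this[of x] this[of x'] show False
      using st(1) x'(1) by simp
  qed
  moreover have "u \<noteq> w" using u w by auto
  moreover have "w \<notin> span {u}" using u w x'(3)
    by (metis empty_subsetI insert_subset span_minimal subsetD subspace_span)
  then have "independent {u, w}"
    using \<open>u \<noteq> 0\<close> independent_insertI[of w "{u}"] by (simp add: insert_commute)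
  ultimately have "span {u, w} \<in> ?S" using upper_radical_iff by blast
  moreover have "span {u} \<subseteq> span {u, w}" by (rule span_mono) auto
  moreover have "span {u} \<subseteq> Y" using u x'(3) by (simp add: span_minimal)
  ultimately have "Y = span {u, w}"
    using spread span_singleton_in_grassmannian[OF \<open>u \<noteq> 0\<close>] Y(1) unfolding line_spread_def by blast
  with w show False by (simp add: span_base)
qed

end


section \<open>Vector spaces with a quadratic operator\<close>

text \<open>
The operator \<open>J\<close> is multiplication by \<open>t\<close> for a structure of vector space over
\<open>K[t] / (t^2 - \<alpha> t - \<beta>)\<close>. The last assumption says that this quotient is a field. The invariant
subspaces of \<open>J\<close> are the subspaces over that field.
\<close>

locale quadratic_structure = vector_space scale
  for scale :: "'k::field \<Rightarrow> 'v::ab_group_add \<Rightarrow> 'v" (infixr \<open>*s\<close> 75) +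
  fixes J :: "'v \<Rightarrow> 'v" and \<alpha> \<beta> :: 'k
  assumes J_add: "J (x + y) = J x + J y"
    and J_scale: "J (c *s x) = c *s J x"
    and J_square: "J (J x) = \<alpha> *s J x + \<beta> *s x"
    and no_eigenvalue: "r^2 \<noteq> \<alpha> * r + \<beta>"
begin

lemma J_zero: "J 0 = 0"
  using J_scale[of 0 0] by simp

lemma J_diff: "J (x - y) = J x - J y"
  using J_add[of "x - y" y] by simp

lemma J_span_invariant:
  assumes "\<And>s. s \<in> S \<Longrightarrow> J s \<in> span S" "x \<in> span S"
  shows "J x \<in> span S"
  using assms(2)
  by (induction rule: span_induct_alt)
    (simp_all add: J_zero J_add J_scale span_zero span_add span_scale assms(1))

text \<open>
Modulo \<open>U\<close> the operator \<open>J\<close> still satisfies its quadratic equation, which has no root in the field,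
so it cannot have an eigenvector there. Concretely, \<open>J + (r - \<alpha>)\<close> maps \<open>J z - r z\<close> to
\<open>\<alpha> r + \<beta> - r^2\<close> times \<open>z\<close>, with a scalar that is not zero.
\<close>

lemma no_eigenvector_modulo_invariant:
  assumes "subspace U" "\<And>u. u \<in> U \<Longrightarrow> J u \<in> U" "z \<notin> U"
  shows "J z - r *s z \<notin> U"
proof
  define u where "u = J z - r *s z"
  assume "J z - r *s z \<in> U"
  then have u: "u \<in> U" by (simp add: u_def)
  have Jz: "J z = u + r *s z" by (simp add: u_def)
  have "J u = \<alpha> *s J z + \<beta> *s z - r *s J z"
    by (simp add: u_def J_diff J_scale J_square)
  then have "J u + (r - \<alpha>) *s u = (\<alpha> * r + \<beta> - r^2) *s z"
    by (simp add: Jz algebra_simps power2_eq_square)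
  moreover have "J u + (r - \<alpha>) *s u \<in> U"
    using assms u by (simp add: subspace_add subspace_scale)
  ultimately have "inverse (\<alpha> * r + \<beta> - r^2) *s ((\<alpha> * r + \<beta> - r^2) *s z) \<in> U"
    using assms(1) by (metis subspace_scale)
  then show False
    using no_eigenvalue[of r] assms(3) by simp
qed

text \<open>
Every step of building a basis over the quadratic extension adds two vectors to a basis over \<open>K\<close>, and
the span stays invariant, so the step can be repeated.
\<close>

lemma independent_adjoin_line:
  assumes "independent S" "\<And>s. s \<in> S \<Longrightarrow> J s \<in> span S" "z \<notin> span S"
  shows "independent (insert z (insert (J z) S))" "J z \<notin> S" "z \<notin> insert (J z) S"
    "\<And>s. s \<in> insert z (insert (J z) S) \<Longrightarrow> J s \<in> span (insert z (insert (J z) S))"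
proof -
  have no: "J z - r *s z \<notin> span S" for r
    using no_eigenvector_modulo_invariant[OF subspace_span] J_span_invariant assms(2,3) by blast
  have "independent (insert z S)"
    using assms independent_insertI by blast
  moreover have Jz: "J z \<notin> span (insert z S)"
    using no by (auto simp: span_insert)
  ultimately have "independent (insert (J z) (insert z S))"
    by (rule independent_insertI[rotated])
  then show "independent (insert z (insert (J z) S))" by (simp add: insert_commute)
  show "J z \<notin> S" using Jz span_base by blast
  have "J z \<noteq> z" using Jz span_base by force
  then show "z \<notin> insert (J z) S" using assms(3) span_base by auto
  fix s assume s: "s \<in> insert z (insert (J z) S)"
  have "z \<in> span (insert z (insert (J z) S))" "J z \<in> span (insert z (insert (J z) S))"
    "span S \<subseteq> span (insert z (insert (J z) S))"
    by (auto intro: span_base intro!: span_mono)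
  with s assms(2) show "J s \<in> span (insert z (insert (J z) S))"
    by (auto simp: J_square span_add span_scale)
qed

lemma independent_J_line:
  assumes "x \<noteq> 0"
  shows "independent {x, J x}" "x \<noteq> J x" "\<And>s. s \<in> {x, J x} \<Longrightarrow> J s \<in> span {x, J x}"
  using independent_adjoin_line[of "{}" x] assms by (simp_all only: independent_empty) auto

end

section \<open>Forms for which a quadratic operator can be moved between the arguments\<close>

text \<open>
The last two assumptions hold for every composition of an alternating trilinear form over the
quadratic extension with a linear functional from the extension to \<open>K\<close>.
\<close>

locale quadratic_trilinear =
  alternating_trilinear scale Basis h + quadratic_structure scale J \<alpha> \<beta>
  for scale :: "'k::field \<Rightarrow> 'v::ab_group_add \<Rightarrow> 'v" (infixr \<open>*s\<close> 75)
    and Basis h J \<alpha> \<beta> +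
  assumes dim6: "card Basis = 6"
    and nonzero: "\<exists>x y z. h x y z \<noteq> 0"
    and J_left_middle: "h (J x) y z = h x (J y) z"
    and J_middle_right: "h x (J y) z = h x y (J z)"
begin

lemma vanishes_on_J_line: "h x (J x) z = 0"
  by (simp add: J_middle_right repeated)

text \<open>
If \<open>y\<close> were not in \<open>\<langle>x, J x\<rangle>\<close>, then \<open>A = \<langle>x, J x, y, J y\<rangle>\<close> and some \<open>\<langle>z, J z\<rangle>\<close> would span the space
together. The form vanishes whenever two arguments are in \<open>A\<close>, since every \<open>J\<close> can be moved to the
third argument, and likewise for \<open>\<langle>z, J z\<rangle>\<close>. One of the two cases always occurs, which would make
the form zero.
\<close>

lemma radical_in_J_line:
  assumes "x \<noteq> 0" and rad: "\<And>z. h x y z = 0"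
  shows "y \<in> span {x, J x}"
proof (rule ccontr)
  assume y: "y \<notin> span {x, J x}"
  let ?A = "{y, J y, x, J x}"
  note Ux = independent_J_line[OF \<open>x \<noteq> 0\<close>]
  note Uy = independent_adjoin_line[OF Ux(1) Ux(3) y]
  have "card ?A \<le> 4" by (simp add: card_insert_if)
  then have "dim (span ?A) < dim UNIV"
    using dim_le_card'[of ?A] dim6 by (simp del: dim_insert)
  then obtain z where z: "z \<notin> span ?A" by (metis UNIV_eq_I less_irrefl)
  note Uz = independent_adjoin_line[OF Uy(1) Uy(4) z]
  have "card (insert z (insert (J z) ?A)) = 6"
    using Uz(2,3) Uy(2,3) Ux(2) by simp
  then have "span (insert z (insert (J z) ?A)) = UNIV"
    using card_ge_dim_independent[OF subset_UNIV Uz(1)] dim6 by auto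
  moreover have "insert z (insert (J z) ?A) = ?A \<union> {z, J z}" by auto
  ultimately have "v \<in> span (?A \<union> {z, J z})" for v by (metis UNIV_I)
  then have split: "\<exists>u p. v = u + p \<and> u \<in> span ?A \<and> p \<in> span {z, J z}" for v
    unfolding span_Un by blast
  have AA: "h u u' v = 0" if "u \<in> span ?A" "u' \<in> span ?A" for u u' v
  proof (rule vanishes_on_spans[OF _ that, where C = "{v}"])
    have rad': "h y x v = 0" for v using rad swap(1)[of y x] by simp
    show "h a b c = 0" if "a \<in> ?A" "b \<in> ?A" "c \<in> {v}" for a b c
      using that by (auto simp: rad rad' repeated J_left_middle J_middle_right)
  qed (simp add: span_base)
  have BB: "h p p' v = 0" if "p \<in> span {z, J z}" "p' \<in> span {z, J z}" for p p' v
    by (rule vanishes_on_spans[OF _ that, where C = "{v}"])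
      (auto simp: repeated J_left_middle J_middle_right span_base)
  have "h v1 v2 v3 = 0" for v1 v2 v3
  proof -
    obtain u1 p1 where 1: "v1 = u1 + p1" "u1 \<in> span ?A" "p1 \<in> span {z, J z}"
      using split[of v1] by blast
    obtain u2 p2 where 2: "v2 = u2 + p2" "u2 \<in> span ?A" "p2 \<in> span {z, J z}"
      using split[of v2] by blast
    obtain u3 p3 where 3: "v3 = u3 + p3" "u3 \<in> span ?A" "p3 \<in> span {z, J z}"
      using split[of v3] by blast
    have "h u1 p2 u3 = 0" "h p1 u2 u3 = 0" "h p1 u2 p3 = 0" "h u1 p2 p3 = 0"
      using AA[of u1 u3 p2] AA[of u2 u3 p1] BB[of p1 p3 u2] BB[of p2 p3 u1] 1 2 3
        swap(2)[of u1 p2 u3] swap(1)[of p1 u2 u3] swap(2)[of u2 p1 u3]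
        swap(2)[of p1 u2 p3] swap(1)[of u1 p2 p3] swap(2)[of p2 u1 p3]
      by simp_all
    then show ?thesis
      using AA[of u1 u2] BB[of p1 p2] 1 2 3 by (simp add: add)
  qed
  with nonzero show False by blast
qed

lemma upper_radical_line_spread:
  "line_spread scale (upper_radical scale (hyperplane_of_form scale h))"
  unfolding line_spread_def
proof (intro conjI ballI)
  let ?S = "upper_radical scale (hyperplane_of_form scale h)"
  show "?S \<subseteq> grassmannian scale 2" by (auto simp: upper_radical_def)
  fix P assume "P \<in> grassmannian scale 1"
  then obtain x where x: "x \<noteq> 0" "P = span {x}" by (rule grassmannian_1_obtain)
  note line = independent_J_line[OF x(1)]
  show "\<exists>!Y. Y \<in> ?S \<and> P \<subseteq> Y"
  proof (intro ex1I conjI)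
    show "span {x, J x} \<in> ?S"
      using upper_radical_iff line vanishes_on_J_line by blast
    show "P \<subseteq> span {x, J x}" unfolding x(2) by (rule span_mono) simp
    fix Y assume Y: "Y \<in> ?S \<and> P \<subseteq> Y"
    then have "Y \<in> grassmannian scale 2" "x \<in> Y"
      using x(2) span_base by (auto simp: upper_radical_def)
    then obtain y where y: "x \<noteq> y" "independent {x, y}" "Y = span {x, y}"
      using grassmannian_2_obtain x(1) by metis
    with Y have "y \<in> span {x, J x}"
      using radical_in_J_line[OF x(1)] upper_radical_iff by blast
    with y have "Y \<subseteq> span {x, J x}" by (simp add: span_minimal span_base)
    moreover have "dim (span {x, J x}) = 2" "dim Y = 2"
      using line y by (simp_all add: dim_eq_card_independent)
    ultimately show "Y = span {x, J x}"
      using subspace_dim_equal y(3) by (metis order_refl subspace_span)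
  qed
qed

end

section \<open>The determinant form of a quadratic extension\<close>

context finite_dimensional_vector_space
begin

lemma coordinates_exist:
  "\<exists>(c :: nat \<Rightarrow> 'b \<Rightarrow> 'a) e :: nat \<Rightarrow> 'b.
    (\<forall>i x y. c i (x + y) = c i x + c i y) \<and> (\<forall>i r x. c i (r *s x) = r * c i x) \<and>
    (\<forall>f. \<forall>i<card Basis. c i (\<Sum>j<card Basis. f j *s e j) = f i) \<and>
    (\<forall>x y. (\<forall>i<card Basis. c i x = c i y) \<longrightarrow> x = y)"
proof -
  obtain e where e: "bij_betw e {..<card Basis} Basis"
    using ex_bij_betw_nat_finite[OF finite_Basis] by (auto simp: atLeast0LessThan)
  define c where "c i x = representation Basis x (e i)" for i x
  note basis = independent_Basis span_Basis
  have 1: "c i (x + y) = c i x + c i y" for i x y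
    by (simp add: c_def representation_add basis)
  have 2: "c i (r *s x) = r * c i x" for i r x
    by (simp add: c_def representation_scale basis)
  have zero: "c i 0 = 0" for i by (simp add: c_def representation_zero)
  have sum: "c i (sum g I) = (\<Sum>j\<in>I. c i (g j))" for i g and I :: "nat set"
    by (induction I rule: infinite_finite_induct) (simp_all add: zero 1)
  have delta: "c i (e j) = (if i = j then 1 else 0)" if "i < card Basis" "j < card Basis" for i j
  proof -
    have "e j \<in> Basis" "e i = e j \<longleftrightarrow> i = j"
      using that e by (auto simp: bij_betw_def inj_on_eq_iff)
    then show ?thesis by (simp add: c_def representation_basis basis)
  qed
  have 3: "c i (\<Sum>j<card Basis. f j *s e j) = f i" if "i < card Basis" for f i
    using that by (simp add: sum 2 delta if_distrib[of "\<lambda>r. f _ * r"] cong: if_cong)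
  have "x = (\<Sum>i<card Basis. c i x *s e i)" for x
  proof -
    have "(\<Sum>i<card Basis. c i x *s e i) = (\<Sum>b\<in>Basis. representation Basis x b *s b)"
      unfolding c_def by (rule sum.reindex_bij_betw[OF e])
    also have "\<dots> = x"
      using sum_representation_eq[of Basis x Basis] finite_Basis by (simp add: basis)
    finally show ?thesis ..
  qed
  then have 4: "x = y" if "\<And>i. i < card Basis \<Longrightarrow> c i x = c i y" for x y
    using that by (metis (no_types, lifting) lessThan_iff sum.cong)
  show ?thesis using 1 2 3 4 by (intro exI[of _ c] exI[of _ e]) simp
qed

text \<open>
The coordinates \<open>i\<close> and \<open>i + 3\<close> of a vector, for \<open>i < 3\<close>, are the coefficients of \<open>1\<close> and \<open>t\<close> of its
\<open>i\<close>-th coordinate in \<open>L = K[t] / (t^2 - \<alpha> t - \<beta>)\<close>. The form is the coefficient of \<open>t\<close> in the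
determinant of the resulting 3 by 3 matrix over \<open>L\<close>. The determinant is a signed sum of products of
three elements of \<open>L\<close>; since these products are symmetric and commute with multiplication by \<open>t\<close>
in each factor, the sum is alternating and \<open>J\<close> can be moved between its arguments.
\<close>

lemma quadratic_trilinear_exists:
  assumes dim6: "card Basis = 6" and no_root: "\<And>r :: 'a. r^2 \<noteq> \<alpha> * r + \<beta>"
  obtains h J where "quadratic_trilinear scale Basis h J \<alpha> \<beta>"
proof -
  obtain c :: "nat \<Rightarrow> 'b \<Rightarrow> 'a" and e :: "nat \<Rightarrow> 'b"
    where coords: "\<forall>i x y. c i (x + y) = c i x + c i y" "\<forall>i r x. c i (r *s x) = r * c i x"
      "\<forall>f. \<forall>i<6. c i (\<Sum>j<6. f j *s e j) = f i"
      "\<forall>x y. (\<forall>i<6. c i x = c i y) \<longrightarrow> x = y"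
    using coordinates_exist unfolding dim6 by (elim exE conjE)
  note c_add = coords(1)[rule_format] and c_scale = coords(2)[rule_format]
    and c_sum = coords(3)[rule_format] and c_ext = coords(4)[rule_format]
  define J where "J x =
    (\<Sum>i<6. (if i < 3 then \<beta> * c (i + 3) x else c (i - 3) x + \<alpha> * c i x) *s e i)" for x
  have c_J: "c i (J x) = (if i < 3 then \<beta> * c (i + 3) x else c (i - 3) x + \<alpha> * c i x)"
    if "i < 6" for i x
    unfolding J_def using c_sum[OF that] by simp
  \<comment> \<open>The coefficient of \<open>t\<close> in \<open>(p + p' t) (q + q' t) (r + r' t)\<close>, expanded with \<open>t^2 = \<alpha> t + \<beta>\<close> and
    \<open>t^3 = (\<alpha>^2 + \<beta>) t + \<alpha> \<beta>\<close>.\<close>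
  define T where "T p p' q q' r r' =
    p' * q * r + p * q' * r + p * q * r' + \<alpha> * (p' * q' * r + p' * q * r' + p * q' * r')
    + (\<alpha>^2 + \<beta>) * (p' * q' * r')" for p p' q q' r r'
  define t where "t i j k x y z =
    T (c i x) (c (i + 3) x) (c j y) (c (j + 3) y) (c k z) (c (k + 3) z)" for i j k x y z
  have T_swap: "T p p' q q' r r' = T q q' p p' r r'" "T p p' q q' r r' = T p p' r r' q q'" for p p' q q' r r'
    by (simp_all add: T_def algebra_simps)
  have t_swap: "t i j k x y z = t j i k y x z" "t i j k x y z = t i k j x z y" for i j k x y z
    unfolding t_def by (rule T_swap)+
  have t_linear: "t i j k (x + x') y z = t i j k x y z + t i j k x' y z"
    "t i j k (s *s x) y z = s * t i j k x y z" for i j k x x' y z s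
    by (simp_all add: t_def T_def c_add c_scale algebra_simps)
  have t_linear': "t i j k x (y + y') z = t i j k x y z + t i j k x y' z"
    "t i j k x (s *s y) z = s * t i j k x y z"
    "t i j k x y (z + z') = t i j k x y z + t i j k x y z'"
    "t i j k x y (s *s z) = s * t i j k x y z" for i j k x y z y' z' s
    using t_linear t_swap by metis+
  have t_J: "t i j k (J x) y z = t i j k x (J y) z" if "i < 3" "j < 3" for i j k x y z
    using that by (simp add: t_def T_def c_J algebra_simps power2_eq_square)
  have t_J': "t i j k x (J y) z = t i j k x y (J z)" if "j < 3" "k < 3" for i j k x y z
    using t_J t_swap that by metis
  define h where "h x y z = t 0 1 2 x y z - t 0 2 1 x y z + t 1 2 0 x y z
    - t 1 0 2 x y z + t 2 0 1 x y z - t 2 1 0 x y z" for x y z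
  have scalars: "vector_space ((*) :: 'a \<Rightarrow> 'a \<Rightarrow> 'a)"
    by unfold_locales (simp_all add: algebra_simps)
  have "alternating_trilinear_form scale h"
    unfolding alternating_trilinear_form_def Vector_Spaces.linear_iff
  proof (intro conjI allI impI scalars vector_space_axioms)
    show "h x y z = 0" if "x = y \<or> x = z \<or> y = z" for x y z
      using that t_swap by (auto simp: h_def)
  qed (simp_all add: h_def t_linear t_linear' algebra_simps)
  moreover have "h (J x) y z = h x (J y) z" "h x (J y) z = h x y (J z)" for x y z
    by (simp_all add: h_def t_J t_J')
  moreover have "\<exists>x y z. h x y z \<noteq> 0"
  proof -
    \<comment> \<open>The first two unit vectors of \<open>L^3\<close>, and \<open>t\<close> times the third one, have determinant \<open>t\<close>.\<close>
    define v where "v k = (\<Sum>j<6. (if j = k then 1 else 0) *s e j)" for k :: nat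
    have "c i (v k) = (if i = k then 1 else 0)" if "i < 6" for i k
      unfolding v_def using c_sum[OF that] by simp
    then have "h (v 0) (v 1) (v 5) = 1"
      by (simp add: h_def t_def T_def)
    then show ?thesis by (metis zero_neq_one)
  qed
  moreover have "J (x + y) = J x + J y" "J (s *s x) = s *s J x" for x y s
    by (rule c_ext, simp add: c_J c_add c_scale algebra_simps)+
  moreover have "J (J x) = \<alpha> *s J x + \<beta> *s x" for x
  proof (rule c_ext)
    fix i :: nat assume "i < 6"
    then have "i - 3 < 3" by linarith
    with \<open>i < 6\<close> show "c i (J (J x)) = c i (\<alpha> *s J x + \<beta> *s x)"
      by (simp add: c_J c_add c_scale algebra_simps)
  qed
  ultimately have "quadratic_trilinear scale Basis h J \<alpha> \<beta>"
    using no_root dim6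
    by unfold_locales
  then show ?thesis by (rule that)
qed

end

section \<open>Existence of induced line-spreads\<close>

theorem theorem2:
  fixes scale :: "'k::field \<Rightarrow> 'v::ab_group_add \<Rightarrow> 'v"
  assumes "vector_space scale"
    and "vector_space.dim scale (UNIV :: 'v set) = 6"
  shows "(\<exists>H. is_hyperplane scale H \<and>
            line_spread scale (upper_radical scale H))
         \<longleftrightarrow> \<not> quadratically_closed TYPE('k)"
proof -
  interpret vector_space scale by fact
  obtain B where B: "independent B" "span B = UNIV" "card B = 6"
    using basis_exists[of UNIV] assms(2) by (metis top.extremum_uniqueI)
  then have "finite B" by (metis card.infinite zero_neq_numeral)
  with B interpret finite_dimensional_vector_space scale B
    by unfold_locales
  show ?thesis
  proof
    assume "\<exists>H. is_hyperplane scale H \<and> line_spread scale (upper_radical scale H)"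
    then obtain h where h: "alternating_trilinear_form scale h"
      "line_spread scale (upper_radical scale (hyperplane_of_form scale h))"
      unfolding is_hyperplane_def by blast
    interpret alternating_trilinear scale B h
      by unfold_locales (rule h(1))
    show "\<not> quadratically_closed TYPE('k)"
      using line_spread_imp_not_quadratically_closed B(3) h(2) by blast
  next
    assume "\<not> quadratically_closed TYPE('k)"
    then obtain \<alpha> \<beta> :: 'k where "\<And>r. r^2 \<noteq> \<alpha> * r + \<beta>"
      using not_quadratically_closed_monic by blast
    then obtain h J where "quadratic_trilinear scale B h J \<alpha> \<beta>"
      using quadratic_trilinear_exists B(3) by metis
    then interpret quadratic_trilinear scale B h J \<alpha> \<beta> .
    show "\<exists>H. is_hyperplane scale H \<and> line_spread scale (upper_radical scale H)"
      using alternating_trilinear nonzero upper_radical_line_spread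
      unfolding is_hyperplane_def by blast
  qed
qed

end
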